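(* Let $\Sigma$ be a finite alphabet and let $X\subset\Sigma^{\mathbb{Z}}$ be a sofic shift with positive entropy. Then no cellular automaton $f:X\to X$ is transitive on $X$ with the Besicovitch topology.
   Context: On $\Sigma^{\mathbb{Z}}$ let $d_B(x,y)=\limsup_{n\to\infty}\frac{1}{2n+1}|\{i\in[-n,n] : x_i\ne y_i\}|$; the Besicovitch topology on $X$ is the topology given by this pseudometric. A subshift is a subset of $\Sigma^{\mathbb{Z}}$ closed in the product topology and invariant under the shift $\sigma(x)_i=x_{i+1}$; a sofic shift is a subshift presented by a finite labeled graph; entropy means the usual topological entropy of the subshift, $\lim_n \frac1n\log|\{w\in\Sigma^n : w \text{ occurs in } X\}|$. A cellular automaton on $X$ is a map $X\to X$ that is continuous in the product topology and commutes with $\sigma$. The map $f$ is transitive on $X$ with the Besicovitch topology if for all nonempty Besicovitch-open sets $U,V\subset X$ there is $n\ge 0$ with $f^n(U)\cap V\neq\emptyset$. *)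

theory Defs
  imports "HOL-Analysis.Analysis" "Graph_Theory.Digraph"
begin

text \<open>The alphabet is a type \<open>'a\<close>, of class \<open>finite\<close> in the statement; bi-infinite
  configurations are functions \<open>int \<Rightarrow> 'a\<close>.\<close>

definition full_shift_topology :: "(int \<Rightarrow> 'a) topology" where
  "full_shift_topology = product_topology (\<lambda>_. discrete_topology UNIV) UNIV"

definition shift :: "(int \<Rightarrow> 'a) \<Rightarrow> (int \<Rightarrow> 'a)" where
  "shift x = (\<lambda>i. x (i + 1))"

definition subshift :: "(int \<Rightarrow> 'a) set \<Rightarrow> bool" where
  "subshift X \<longleftrightarrow> closedin full_shift_topology X \<and> shift ` X = X"

text \<open>The configurations read along the bi-infinite paths of a digraph with arc labels \<open>lab\<close>.
  Loops and parallel arcs are allowed.\<close>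

definition presented_shift :: "('v, 'e) pre_digraph \<Rightarrow> ('e \<Rightarrow> 'a) \<Rightarrow> (int \<Rightarrow> 'a) set" where
  "presented_shift G lab = {(\<lambda>i. lab (p i)) | p :: int \<Rightarrow> 'e.
     \<forall>i. p i \<in> arcs G \<and> head G (p i) = tail G (p (i + 1))}"

text \<open>Every finite labeled graph is isomorphic to one whose vertices and arcs are natural numbers.\<close>

definition sofic_shift :: "(int \<Rightarrow> 'a) set \<Rightarrow> bool" where
  "sofic_shift X \<longleftrightarrow> subshift X \<and>
     (\<exists>(G :: (nat, nat) pre_digraph) lab. fin_digraph G \<and> X = presented_shift G lab)"

definition words :: "(int \<Rightarrow> 'a) set \<Rightarrow> nat \<Rightarrow> 'a list set" where
  "words X n = {w. length w = n \<and> (\<exists>x\<in>X. \<exists>i. \<forall>k<n. w ! k = x (i + int k))}"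

text \<open>By subadditivity the limit exists for every nonempty subshift over a finite alphabet. As
  \<open>ln 0 = 0\<close>, the empty shift gets entropy \<open>0\<close> (instead of \<open>-\<infinity>\<close>).\<close>

definition entropy :: "(int \<Rightarrow> 'a) set \<Rightarrow> real" where
  "entropy X = lim (\<lambda>n. ln (real (card (words X n))) / real n)"

definition cellular_automaton ::
  "(int \<Rightarrow> 'a) set \<Rightarrow> ((int \<Rightarrow> 'a) \<Rightarrow> (int \<Rightarrow> 'a)) \<Rightarrow> bool" where
  "cellular_automaton X f \<longleftrightarrow>
     continuous_map (subtopology full_shift_topology X) (subtopology full_shift_topology X) f \<and>
     (\<forall>x\<in>X. f (shift x) = shift (f x))"

text \<open>The terms of the limsup lie in \<open>[0, 1]\<close>, so nothing is lost by \<open>real_of_ereal\<close>.\<close>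

definition besicovitch_dist :: "(int \<Rightarrow> 'a) \<Rightarrow> (int \<Rightarrow> 'a) \<Rightarrow> real" where
  "besicovitch_dist x y = real_of_ereal (limsup (\<lambda>n.
     ereal (real (card {i \<in> {- int n..int n}. x i \<noteq> y i}) / (2 * real n + 1))))"

definition besicovitch_topology :: "(int \<Rightarrow> 'a) set \<Rightarrow> (int \<Rightarrow> 'a) topology" where
  "besicovitch_topology X = topology (\<lambda>U. U \<subseteq> X \<and>
     (\<forall>x\<in>U. \<exists>\<epsilon>>0. \<forall>y\<in>X. besicovitch_dist x y < \<epsilon> \<longrightarrow> y \<in> U))"

lemma openin_besicovitch_topology:
  "openin (besicovitch_topology X) U \<longleftrightarrow> U \<subseteq> X \<and>
     (\<forall>x\<in>U. \<exists>\<epsilon>>0. \<forall>y\<in>X. besicovitch_dist x y < \<epsilon> \<longrightarrow> y \<in> U)"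
proof -
  let ?P = "\<lambda>U. U \<subseteq> X \<and> (\<forall>x\<in>U. \<exists>\<epsilon>>0. \<forall>y\<in>X. besicovitch_dist x y < \<epsilon> \<longrightarrow> y \<in> U)"
  have "?P (S \<inter> T)" if S: "?P S" and T: "?P T" for S T
  proof (intro conjI ballI)
    show "S \<inter> T \<subseteq> X" using S by blast
  next
    fix x assume "x \<in> S \<inter> T"
    then obtain d e where "d > 0" "\<forall>y\<in>X. besicovitch_dist x y < d \<longrightarrow> y \<in> S"
      "e > 0" "\<forall>y\<in>X. besicovitch_dist x y < e \<longrightarrow> y \<in> T"
      using S T by blast
    then have "min d e > 0 \<and> (\<forall>y\<in>X. besicovitch_dist x y < min d e \<longrightarrow> y \<in> S \<inter> T)"
      by simp
    then show "\<exists>\<epsilon>>0. \<forall>y\<in>X. besicovitch_dist x y < \<epsilon> \<longrightarrow> y \<in> S \<inter> T"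
      by (rule exI)
  qed
  moreover have "?P (\<Union>K)" if K: "\<forall>S\<in>K. ?P S" for K
  proof (intro conjI ballI)
    show "\<Union>K \<subseteq> X" using K by blast
  next
    fix x assume "x \<in> \<Union>K"
    then obtain S where "S \<in> K" "x \<in> S" by blast
    moreover from this obtain e where "e > 0" "\<forall>y\<in>X. besicovitch_dist x y < e \<longrightarrow> y \<in> S"
      using K by blast
    ultimately show "\<exists>\<epsilon>>0. \<forall>y\<in>X. besicovitch_dist x y < \<epsilon> \<longrightarrow> y \<in> \<Union>K" by blast
  qed
  ultimately have "istopology ?P"
    unfolding istopology_def by blast
  then show ?thesis
    unfolding besicovitch_topology_def by (simp add: topology_inverse')
qed

lemma topspace_besicovitch_topology: "topspace (besicovitch_topology X) = X"
proof -
  have "openin (besicovitch_topology X) X"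
    unfolding openin_besicovitch_topology using zero_less_one by blast
  then show ?thesis
    using openin_besicovitch_topology[of X "topspace (besicovitch_topology X)"]
    by (simp add: openin_subset subset_antisym)
qed

definition topologically_transitive :: "'b topology \<Rightarrow> ('b \<Rightarrow> 'b) \<Rightarrow> bool" where
  "topologically_transitive T f \<longleftrightarrow>
     (\<forall>U V. openin T U \<and> openin T V \<and> U \<noteq> {} \<and> V \<noteq> {} \<longrightarrow>
        (\<exists>n. (f ^^ n) ` U \<inter> V \<noteq> {}))"

end

theory Submission
  imports Defs "Graph_Theory.Arc_Walk" "HOL-Real_Asymp.Real_Asymp"
begin

text \<open>A counting argument. In a presentation of \<open>X\<close>, if at every vertex all cycles of equal length had
  the same label, then cutting walks at last visits would show that words grow polynomially. So some
  vertex has two cycles of equal length \<open>L\<close> with distinct labels \<open>a\<close>, \<open>b\<close>, and all concatenations of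
  \<open>a\<close> and \<open>b\<close> lie in \<open>X\<close>. Let \<open>p\<close> be the periodic point \<open>\<dots>aaa\<dots>\<close>. As \<open>f ^^ n\<close> has some finite radius
  \<open>r n\<close>, the images under \<open>f ^^ n\<close> of the points within Besicovitch distance \<open>e\<close> of \<open>p\<close> show, up to
  further errors of density \<open>e\<close>, at most \<open>exp (c N)\<close> central words of radius \<open>N\<close>, where \<open>c\<close> is small
  with \<open>e\<close>, as soon as \<open>N\<close> is large compared with \<open>r n\<close>. This is less than the number of
  concatenations, so a diagonal construction yields a concatenation \<open>v\<close> which for every \<open>n\<close> avoids
  these words at infinitely many scales. Then no \<open>f ^^ n\<close> maps a point of the \<open>e\<close>-ball around \<open>p\<close>
  into the \<open>e\<close>-ball around \<open>v\<close>.\<close>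

section \<open>Counting walk labels when cycle labels depend only on vertex and length\<close>

definition (in pre_digraph) walk_labels :: "('b \<Rightarrow> 'c) \<Rightarrow> 'a set \<Rightarrow> 'a \<Rightarrow> nat \<Rightarrow> 'c list set" where
  "walk_labels lab S u n =
     {map lab es | es v. awalk u es v \<and> head G ` set es \<subseteq> S \<and> length es = n}"

lemma (in fin_digraph) finite_walk_labels: "finite (walk_labels lab S u n)"
proof -
  have "walk_labels lab S u n \<subseteq> {w. set w \<subseteq> lab ` arcs G \<and> length w = n}"
    by (force simp: walk_labels_def awalk_def)
  then show ?thesis
    by (rule finite_subset) (simp add: finite_lists_length_eq)
qed

text \<open>Under the uniqueness assumption of the next lemmas this is the label of every cycle of
  length \<open>k\<close> at \<open>u\<close>. Where no such cycle exists the value is arbitrary,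
  which can only enlarge the covering set below.\<close>

definition (in pre_digraph) cycle_label :: "('b \<Rightarrow> 'c) \<Rightarrow> 'a \<Rightarrow> nat \<Rightarrow> 'c list" where
  "cycle_label lab u k = (SOME w. \<exists>es. awalk u es u \<and> length es = k \<and> w = map lab es)"

text \<open>Cut a walk at its last visit to the initial vertex.\<close>

lemma (in fin_digraph) walk_labels_subset:
  assumes unique: "\<And>v es fs. awalk v es v \<Longrightarrow> awalk v fs v \<Longrightarrow> length es = length fs \<Longrightarrow>
      map lab es = map lab fs"
  shows "walk_labels lab S u n \<subseteq> insert (cycle_label lab u n)
    (\<Union>(k, e)\<in>{..<n} \<times> {e \<in> arcs G. head G e \<in> S - {u}}.
       (\<lambda>w. cycle_label lab u k @ lab e # w) ` walk_labels lab (S - {u}) (head G e) (n - Suc k))"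
proof
  fix w assume "w \<in> walk_labels lab S u n"
  then obtain es v where w: "w = map lab es" "awalk u es v" "head G ` set es \<subseteq> S" "length es = n"
    unfolding walk_labels_def by blast
  have cycle: "map lab xs = cycle_label lab u (length xs)" if "awalk u xs u" for xs
  proof -
    have "\<exists>ys. awalk u ys u \<and> length ys = length xs \<and> cycle_label lab u (length xs) = map lab ys"
      unfolding cycle_label_def
      by (rule someI_ex) (use that in blast)
    then show ?thesis using unique that by metis
  qed
  \<comment> \<open>\<open>xs\<close> ends at the last visit to \<open>u\<close> and is empty if the
    walk never returns; \<open>ys\<close> is what follows.\<close>
  obtain xs ys where es: "es = xs @ ys" "awalk u xs u" "awalk u ys v" "u \<notin> head G ` set ys"
  proof (cases "u \<in> head G ` set es")
    case False
    then show ?thesis using that[of "[]" es] w by (auto simp: awalk_def)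
  next
    case True
    then obtain xs e ys where s: "es = xs @ e # ys" "head G e = u" "\<forall>z\<in>set ys. head G z \<noteq> u"
      using split_list_last_prop[of es "\<lambda>e. head G e = u"] by auto
    from w(2) s(1,2) have "awalk u (xs @ [e]) u \<and> awalk u ys v"
      by (metis append.assoc append_Cons append_Nil awalk_append_iff awalk_Cons_iff awalk_empty_ends awalk_Nil_iff)
    moreover have "u \<notin> head G ` set ys" using s(3) by auto
    ultimately show ?thesis using that[of "xs @ [e]" ys] s(1) by simp
  qed
  show "w \<in> insert (cycle_label lab u n)
    (\<Union>(k, e)\<in>{..<n} \<times> {e \<in> arcs G. head G e \<in> S - {u}}.
       (\<lambda>w. cycle_label lab u k @ lab e # w) ` walk_labels lab (S - {u}) (head G e) (n - Suc k))"
  proof (cases ys)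
    case Nil
    then show ?thesis using w es cycle by auto
  next
    case (Cons e zs)
    have aw: "awalk (head G e) zs v" "e \<in> arcs G"
      using es(3) unfolding Cons by (auto simp: awalk_Cons_iff)
    have "head G ` set zs \<subseteq> S - {u}" "head G e \<in> S - {u}"
      using w(3) es Cons by auto
    then have "map lab zs \<in> walk_labels lab (S - {u}) (head G e) (n - Suc (length xs))"
      unfolding walk_labels_def using aw w(4) es(1) Cons by auto
    moreover have "w = cycle_label lab u (length xs) @ lab e # map lab zs"
      using w(1) es(1,2) Cons cycle by simp
    moreover have "length xs < n" using w(4) es(1) Cons by simp
    ultimately show ?thesis using aw(2) \<open>head G e \<in> S - {u}\<close> by blast
  qed
qed

text \<open>Each cut leaves fewer than \<open>Suc n\<close> lengths for the cycle and at most
  \<open>card (arcs G)\<close> arcs leaving it, and then \<open>u\<close> is never visited again. So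
  the allowed vertex set \<open>S\<close> loses an element, which bounds the number of cuts
  independently of \<open>n\<close>.\<close>

lemma (in fin_digraph) card_walk_labels_le:
  assumes unique: "\<And>v es fs. awalk v es v \<Longrightarrow> awalk v fs v \<Longrightarrow> length es = length fs \<Longrightarrow>
      map lab es = map lab fs"
    and "finite S" "u \<in> S"
  shows "card (walk_labels lab S u n) \<le> (Suc (card (arcs G)) * Suc n) ^ card S"
  using assms(2,3)
proof (induction "card S" arbitrary: S u n)
  case 0
  then show ?case by auto
next
  case (Suc c)
  let ?B = "Suc (card (arcs G)) * Suc n"
  let ?I = "{..<n} \<times> {e \<in> arcs G. head G e \<in> S - {u}}"
  let ?g = "\<lambda>(k, e). (\<lambda>w. cycle_label lab u k @ lab e # w) `
      walk_labels lab (S - {u}) (head G e) (n - Suc k)"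
  have cS: "card (S - {u}) = c" using Suc by simp
  have le: "card (?g i) \<le> ?B ^ c" if "i \<in> ?I" for i
  proof -
    obtain k e where i: "i = (k, e)" by (cases i)
    have "card (?g i) \<le> card (walk_labels lab (S - {u}) (head G e) (n - Suc k))"
      unfolding i by (simp add: card_image_le finite_walk_labels)
    also have "\<dots> \<le> (Suc (card (arcs G)) * Suc (n - Suc k)) ^ c"
      using Suc.hyps(1)[of "S - {u}" "head G e" "n - Suc k"] cS Suc.prems that i by simp
    also have "\<dots> \<le> ?B ^ c"
      by (intro power_mono mult_le_mono) auto
    finally show ?thesis .
  qed
  have fin: "finite ?I" by simp
  have "card (walk_labels lab S u n) \<le> card (insert (cycle_label lab u n) (\<Union>i\<in>?I. ?g i))"
    by (intro card_mono finite.insertI finite_UN_I fin)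
      (use walk_labels_subset[OF unique] in \<open>auto simp: finite_walk_labels\<close>)
  also have "\<dots> \<le> Suc (card (\<Union>i\<in>?I. ?g i))"
    by (rule card_insert_le_m1) auto
  also have "card (\<Union>i\<in>?I. ?g i) \<le> (\<Sum>i\<in>?I. card (?g i))"
    by (rule card_UN_le[OF fin])
  also have "\<dots> \<le> card ?I * ?B ^ c"
    using sum_bounded_above[of ?I "\<lambda>i. card (?g i)" "?B ^ c"] le by simp
  also have "card ?I \<le> n * card (arcs G)"
    unfolding card_cartesian_product card_lessThan
    by (intro mult_le_mono2 card_mono) auto
  \<comment> \<open>The summand 1 comes from the walks that end in \<open>u\<close>; the two
    \<open>Suc\<close> in the base absorb it.\<close>
  also have "Suc (n * card (arcs G) * ?B ^ c) \<le> ?B ^ Suc c"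
  proof -
    have "1 \<le> ?B ^ c" by (intro one_le_power) simp
    then have "Suc (n * card (arcs G) * ?B ^ c) \<le> Suc (n * card (arcs G)) * ?B ^ c" by simp
    also have "\<dots> \<le> ?B * ?B ^ c" by (intro mult_le_mono1) simp
    finally show ?thesis by simp
  qed
  finally show ?case using Suc.hyps(2) by simp
qed

lemma (in wf_digraph) awalk_biinfinite_path:
  assumes "\<And>i. p i \<in> arcs G \<and> head G (p i) = tail G (p (i + 1))"
  shows "awalk (tail G (p i)) (map (\<lambda>k. p (i + int k)) [0..<n]) (tail G (p (i + int n)))"
proof (induction n)
  case 0
  then show ?case using assms by (simp add: awalk_Nil_iff)
next
  case (Suc n)
  have "awalk (tail G (p (i + int n))) [p (i + int n)] (tail G (p (i + int (Suc n))))"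
    using assms[of "i + int n"] head_in_verts[of "p (i + int n)"]
    by (simp add: awalk_Cons_iff awalk_Nil_iff ac_simps)
  with Suc show ?case
    by (auto intro: awalk_appendI)
qed

text \<open>Every word is read along a segment of a bi-infinite path, so summing the walk count over
  the initial vertices suffices.\<close>

lemma (in fin_digraph) card_words_le:
  assumes unique: "\<And>v es fs. awalk v es v \<Longrightarrow> awalk v fs v \<Longrightarrow> length es = length fs \<Longrightarrow>
      map lab es = map lab fs"
  shows "card (words (presented_shift G lab) n) \<le>
     card (verts G) * (Suc (card (arcs G)) * Suc n) ^ card (verts G)"
proof -
  have "words (presented_shift G lab) n \<subseteq> (\<Union>u\<in>verts G. walk_labels lab (verts G) u n)"
  proof
    fix w assume "w \<in> words (presented_shift G lab) n"
    then obtain p i where len: "length w = n"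
      and p: "\<And>i. p i \<in> arcs G \<and> head G (p i) = tail G (p (i + 1))"
      and w: "\<And>k. k < n \<Longrightarrow> w ! k = lab (p (i + int k))"
      unfolding words_def presented_shift_def by blast
    let ?es = "map (\<lambda>k. p (i + int k)) [0..<n]"
    have "w = map lab ?es" using len w by (intro nth_equalityI) auto
    moreover have "head G ` set ?es \<subseteq> verts G" using p by auto
    moreover have "length ?es = n" by simp
    ultimately have "w \<in> walk_labels lab (verts G) (tail G (p i)) n"
      unfolding walk_labels_def using awalk_biinfinite_path[of p i n, OF p] by blast
    then show "w \<in> (\<Union>u\<in>verts G. walk_labels lab (verts G) u n)" using p by auto
  qed
  then have "card (words (presented_shift G lab) n) \<le> card (\<Union>u\<in>verts G. walk_labels lab (verts G) u n)"
    by (intro card_mono) (auto simp: finite_walk_labels)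
  also have "\<dots> \<le> (\<Sum>u\<in>verts G. card (walk_labels lab (verts G) u n))"
    by (rule card_UN_le) simp
  also have "\<dots> \<le> card (verts G) * (Suc (card (arcs G)) * Suc n) ^ card (verts G)"
    using sum_bounded_above[of "verts G" "\<lambda>u. card (walk_labels lab (verts G) u n)"
        "(Suc (card (arcs G)) * Suc n) ^ card (verts G)"]
      card_walk_labels_le[OF unique] by simp
  finally show ?thesis .
qed

lemma entropy_eq_0_if_polynomial:
  assumes "\<And>n. card (words X n) \<le> a * (b * Suc n) ^ d"
  shows "entropy X = 0"
proof -
  have "(\<lambda>n. ln (real (card (words X n))) / real n) \<longlonglongrightarrow> 0"
  proof (rule real_tendsto_sandwich)
    show "\<forall>\<^sub>F n in sequentially. 0 \<le> ln (real (card (words X n))) / real n"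
    proof (intro always_eventually allI)
      fix n show "0 \<le> ln (real (card (words X n))) / real n"
        by (cases "card (words X n) = 0") auto
    qed
    show "\<forall>\<^sub>F n in sequentially. ln (real (card (words X n))) / real n \<le>
       (ln (Suc a) + real d * (ln (Suc b) + ln (Suc n))) / real n"
    proof (intro always_eventually allI divide_right_mono)
      fix n
      \<comment> \<open>Passing to \<open>Suc a\<close> and \<open>Suc b\<close> makes all factors
        positive, so that the logarithm splits.\<close>
      have "real (card (words X n)) \<le> real (Suc a * (Suc b * Suc n) ^ d)"
        by (intro of_nat_mono order.trans[OF assms] mult_le_mono power_mono) auto
      also have "\<dots> = real (Suc a) * (real (Suc b) * real (Suc n)) ^ d"
        by (simp only: of_nat_mult of_nat_power)
      finally have le: "real (card (words X n)) \<le> real (Suc a) * (real (Suc b) * real (Suc n)) ^ d" .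
      show "ln (real (card (words X n))) \<le> ln (Suc a) + real d * (ln (Suc b) + ln (Suc n))"
      proof (cases "card (words X n) = 0")
        case True
        then show ?thesis by simp
      next
        case False
        then have "ln (real (card (words X n))) \<le> ln (real (Suc a) * (real (Suc b) * real (Suc n)) ^ d)"
          using le by (subst ln_le_cancel_iff) auto
        also have "\<dots> = ln (Suc a) + real d * (ln (Suc b) + ln (Suc n))"
          by (simp only: ln_mult_pos ln_realpow of_nat_0_less_iff zero_less_Suc zero_less_power mult_pos_pos)
        finally show ?thesis .
      qed
    qed simp
    show "(\<lambda>n. (ln (Suc a) + real d * (ln (Suc b) + ln (Suc n))) / real n) \<longlonglongrightarrow> 0"
      by real_asymp
  qed simp
  then show ?thesis unfolding entropy_def by (rule limI)
qed

section \<open>Free concatenations of two blocks inside the sofic shift\<close>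

text \<open>Integer \<open>div\<close> and \<open>mod\<close> round downwards, so the blocks also
  tile the negative half-line. The entry type is left open because the construction is applied both
  to arcs and to their labels.\<close>

definition block_config :: "nat \<Rightarrow> 'a list \<Rightarrow> 'a list \<Rightarrow> (int \<Rightarrow> bool) \<Rightarrow> int \<Rightarrow> 'a" where
  "block_config L a b s i = (if s (i div int L) then a else b) ! nat (i mod int L)"

lemma (in pre_digraph) cas_consecutive:
  "cas u es v \<Longrightarrow> Suc k < length es \<Longrightarrow> head G (es ! k) = tail G (es ! Suc k)"
proof (induction es arbitrary: u k)
  case (Cons e es)
  then show ?case
    by (cases es; cases k) auto
qed simp

lemma (in pre_digraph) cas_last: "cas u es v \<Longrightarrow> es \<noteq> [] \<Longrightarrow> head G (es ! (length es - 1)) = v"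
proof (induction es arbitrary: u)
  case (Cons e es)
  then show ?case
    by (cases es) auto
qed simp

text \<open>Concatenate the cycles themselves: inside a block consecutive arcs match, and at a block
  boundary both arcs meet in \<open>v\<close>. Reading labels commutes with concatenation.\<close>

lemma (in wf_digraph) block_config_in_presented_shift:
  assumes es: "awalk v es v" "length es = L" and fs: "awalk v fs v" "length fs = L" and "L > 0"
  shows "block_config L (map lab es) (map lab fs) s \<in> presented_shift G lab"
proof -
  define q where "q = block_config L es fs s"
  have mod: "nat (i mod int L) < L" for i using \<open>L > 0\<close> by (simp add: nat_less_iff)
  have in_arcs: "q i \<in> arcs G" for i
  proof -
    have "q i \<in> set es \<union> set fs"
      unfolding q_def block_config_def using mod[of i] es(2) fs(2) by auto
    then show ?thesis using es fs by (auto simp: awalk_def)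
  qed
  have ends: "head G (zs ! (L - 1)) = v" "tail G (zs ! 0) = v"
    "\<And>k. Suc k < L \<Longrightarrow> head G (zs ! k) = tail G (zs ! Suc k)"
    if "zs = es \<or> zs = fs" for zs
  proof -
    have "cas v zs v" "length zs = L" using that es fs by (auto simp: awalk_def)
    then show "head G (zs ! (L - 1)) = v" "tail G (zs ! 0) = v"
      "\<And>k. Suc k < L \<Longrightarrow> head G (zs ! k) = tail G (zs ! Suc k)"
      using cas_last[of v zs v] cas_consecutive[of v zs v] \<open>L > 0\<close> by (auto simp: cas_simp hd_conv_nth)
  qed
  have adj: "head G (q i) = tail G (q (i + 1))" for i
  proof (cases "i mod int L + 1 = int L")
    case True
    have "(i + 1) mod int L = 0"
      using True by (metis mod_add_left_eq mod_self)
    then have "tail G (q (i + 1)) = v"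
      unfolding q_def block_config_def using ends(2) by simp
    moreover have "nat (i mod int L) = L - 1" using True by linarith
    then have "head G (q i) = v"
      unfolding q_def block_config_def using ends(1) by simp
    ultimately show ?thesis by simp
  next
    case False
    have b: "0 \<le> i mod int L" "i mod int L < int L" using \<open>L > 0\<close> by auto
    have i1: "i + 1 = (i mod int L + 1) + (i div int L) * int L" by simp
    have "(i + 1) mod int L = i mod int L + 1"
      by (subst i1, subst mod_mult_self1) (use b False in simp)
    moreover have "(i + 1) div int L = i div int L"
      by (subst i1, subst div_mult_self1) (use b False in auto)
    ultimately show ?thesis
      unfolding q_def block_config_def
      using ends(3)[of "if s (i div int L) then es else fs" "nat (i mod int L)"] b False
      by (auto simp: nat_add_distrib)
  qed
  have "block_config L (map lab es) (map lab fs) s = (\<lambda>i. lab (q i))"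
    unfolding q_def block_config_def using mod es(2) fs(2) by fastforce
  then show ?thesis
    unfolding presented_shift_def using in_arcs adj by blast
qed

lemma sofic_positive_entropy_blocks:
  assumes "sofic_shift X" "entropy X > 0"
  obtains L a b where "L > 0" "length a = L" "length b = L" "a \<noteq> b"
    "\<And>s. block_config L a b s \<in> X"
proof -
  obtain G :: "(nat, nat) pre_digraph" and lab where "fin_digraph G" and X: "X = presented_shift G lab"
    using assms(1) unfolding sofic_shift_def by blast
  then interpret fin_digraph G by simp
  have "\<exists>v es fs. awalk v es v \<and> awalk v fs v \<and> length es = length fs \<and> map lab es \<noteq> map lab fs"
  proof (rule ccontr)
    assume "\<not> ?thesis"
    then have "card (words X n) \<le> card (verts G) * (Suc (card (arcs G)) * Suc n) ^ card (verts G)" for n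
      unfolding X by (intro card_words_le) blast
    then have "entropy X = 0" by (rule entropy_eq_0_if_polynomial)
    then show False using assms(2) by simp
  qed
  then obtain v es fs where c: "awalk v es v" "awalk v fs v" "length es = length fs"
    "map lab es \<noteq> map lab fs"
    by blast
  \<comment> \<open>Two empty cycles would have the same label.\<close>
  have "length fs > 0" using c(3,4) by (cases fs) auto
  then have "block_config (length fs) (map lab es) (map lab fs) s \<in> X" for s
    unfolding X using block_config_in_presented_shift[OF c(1,3,2)] by simp
  then show ?thesis
    using that[of "length fs" "map lab es" "map lab fs"] c \<open>length fs > 0\<close> by simp
qed

section \<open>Finite radius of cellular automata and their iterates\<close>

lemma cylinder_open:
  fixes x :: "int \<Rightarrow> 'a"
  shows "openin full_shift_topology {y. \<forall>i\<in>{-m..m}. y i = x i}"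
proof -
  have "{y. \<forall>i\<in>{-m..m}. y i = x i} = PiE UNIV (\<lambda>i. if i \<in> {-m..m} then {x i} else UNIV)"
    by (auto simp: PiE_def Pi_def split: if_splits)
  moreover have "finite {i. (if i \<in> {-m..m} then {x i} else UNIV) \<noteq> (UNIV :: 'a set)}"
    by (rule finite_subset[of _ "{-m..m}"]) auto
  ultimately show ?thesis
    unfolding full_shift_topology_def by (simp add: openin_PiE_gen)
qed

lemma cylinder_nbhd:
  assumes "openin full_shift_topology U" "x \<in> U"
  obtains m :: nat where "{y. \<forall>i\<in>{- int m..int m}. y i = x i} \<subseteq> U"
proof -
  obtain B where B: "finite {i. B i \<noteq> UNIV}" "x \<in> PiE UNIV B" "PiE UNIV B \<subseteq> U"
    using assms unfolding full_shift_topology_def openin_product_topology_alt by auto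
  obtain m where m: "\<And>i. B i \<noteq> UNIV \<Longrightarrow> nat \<bar>i\<bar> \<le> m"
    using finite_imageI[OF B(1), of "\<lambda>i. nat \<bar>i\<bar>"] unfolding finite_nat_set_iff_bounded_le by auto
  have "y \<in> U" if "\<forall>i\<in>{- int m..int m}. y i = x i" for y
  proof -
    have "y i \<in> B i" for i
    proof (cases "B i = UNIV")
      case False
      then have "i \<in> {- int m..int m}" using m[OF False] by auto
      then show ?thesis using that B(2) by auto
    qed simp
    then show ?thesis using B(3) by auto
  qed
  then show ?thesis using that by blast
qed

text \<open>Steps to the left use that \<open>shift\<close> maps \<open>X\<close> onto itself: a
  preimage \<open>z\<close> exists in \<open>X\<close>, and injectivity of \<open>shift\<close>
  determines both \<open>z\<close> and \<open>g z\<close>.\<close>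

lemma shift_commuting_translate:
  assumes X: "shift ` X = X" and comm: "\<And>x. x \<in> X \<Longrightarrow> g (shift x) = shift (g x)" and "x \<in> X"
  shows "(\<lambda>i. x (i + j)) \<in> X \<and> g (\<lambda>i. x (i + j)) = (\<lambda>i. g x (i + j))"
proof (induction j rule: int_induct[of _ 0])
  case base
  then show ?case using \<open>x \<in> X\<close> by simp
next
  case (step1 j)
  have "shift (\<lambda>i. x (i + j)) \<in> X" using step1 X by blast
  moreover have "g (shift (\<lambda>i. x (i + j))) = shift (\<lambda>i. g x (i + j))" using step1 comm by simp
  ultimately show ?case by (simp add: shift_def ac_simps)
next
  case (step2 j)
  then obtain z where z: "z \<in> X" "(\<lambda>i. x (i + j)) = shift z" using X by blast
  have "z = (\<lambda>i. x (i + (j - 1)))"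
  proof
    fix i
    show "z i = x (i + (j - 1))"
      using fun_cong[OF z(2), of "i - 1"] by (simp add: shift_def algebra_simps)
  qed
  moreover have "g z = (\<lambda>i. g x (i + (j - 1)))"
  proof
    fix i
    have "shift (g z) = (\<lambda>i. g x (i + j))" using step2 z comm by metis
    from fun_cong[OF this, of "i - 1"] show "g z i = g x (i + (j - 1))"
      by (simp add: shift_def algebra_simps)
  qed
  ultimately show ?case using z by simp
qed

text \<open>By continuity, each point of \<open>X\<close> has a cylinder on which coordinate 0 of
  the image is constant. Compactness leaves finitely many cylinders, whose largest radius serves for
  coordinate 0; translation carries it to every \<open>j\<close>.\<close>

lemma curtis_hedlund_lyndon:
  fixes X :: "(int \<Rightarrow> 'a::finite) set"
  assumes "subshift X" "cellular_automaton X g"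
  obtains r :: nat where "\<And>x y j. x \<in> X \<Longrightarrow> y \<in> X \<Longrightarrow>
    (\<And>i. i \<in> {j - int r..j + int r} \<Longrightarrow> x i = y i) \<Longrightarrow> g x j = g y j"
proof -
  let ?T = "full_shift_topology :: (int \<Rightarrow> 'a) topology"
  have closed: "closedin ?T X" and X: "shift ` X = X"
    using assms(1) by (auto simp: subshift_def)
  have cont: "continuous_map (subtopology ?T X) (subtopology ?T X) g"
    and comm: "\<And>x. x \<in> X \<Longrightarrow> g (shift x) = shift (g x)"
    using assms(2) by (auto simp: cellular_automaton_def)
  have "compact_space ?T"
    unfolding full_shift_topology_def compact_space_product_topology
    by (simp add: compact_space_discrete_topology)
  then have compact: "compactin ?T X" using closed by (rule closedin_compact_space)
  have "\<exists>m. \<forall>y\<in>X. (\<forall>i\<in>{- int m..int m}. y i = x i) \<longrightarrow> g y 0 = g x 0" if "x \<in> X" for x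
  proof -
    have "continuous_map (subtopology ?T X) (discrete_topology UNIV) (\<lambda>x. g x 0)"
      using cont continuous_map_componentwise_UNIV[of "subtopology ?T X" "\<lambda>_. discrete_topology UNIV" g]
      unfolding full_shift_topology_def continuous_map_in_subtopology by simp
    then have "openin (subtopology ?T X) {y \<in> topspace (subtopology ?T X). g y 0 \<in> {g x 0}}"
      by (rule openin_continuous_map_preimage) simp
    then obtain U where U: "openin ?T U"
        "{y \<in> topspace (subtopology ?T X). g y 0 \<in> {g x 0}} = U \<inter> X"
      unfolding openin_subtopology by auto
    have top: "topspace (subtopology ?T X) = X"
      using closedin_subset[OF closed] by auto
    have "x \<in> U" using U(2) that top by auto
    then obtain m :: nat where "{y. \<forall>i\<in>{- int m..int m}. y i = x i} \<subseteq> U"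
      using cylinder_nbhd U(1) by blast
    then show ?thesis using U(2) top by blast
  qed
  then obtain m :: "(int \<Rightarrow> 'a) \<Rightarrow> nat" where m:
    "\<And>x y. x \<in> X \<Longrightarrow> y \<in> X \<Longrightarrow> (\<forall>i\<in>{- int (m x)..int (m x)}. y i = x i) \<Longrightarrow> g y 0 = g x 0"
    by metis
  let ?C = "\<lambda>x. {y. \<forall>i\<in>{- int (m x)..int (m x)}. y i = x i}"
  have "\<forall>U\<in>?C ` X. openin ?T U" using cylinder_open by blast
  moreover have "X \<subseteq> \<Union>(?C ` X)" by auto
  ultimately have "\<exists>F. finite F \<and> F \<subseteq> ?C ` X \<and> X \<subseteq> \<Union>F"
    using compact unfolding compactin_def by meson
  then obtain F where F: "finite F" "F \<subseteq> X" "X \<subseteq> \<Union>(?C ` F)"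
    by (metis (no_types, lifting) finite_subset_image)
  obtain r where r: "\<And>x. x \<in> F \<Longrightarrow> m x \<le> r"
    using finite_imageI[OF F(1), of m] unfolding finite_nat_set_iff_bounded_le by auto
  have zero: "g x 0 = g y 0"
    if xy: "x \<in> X" "y \<in> X" and eq: "\<And>i. i \<in> {- int r..int r} \<Longrightarrow> x i = y i" for x y
  proof -
    \<comment> \<open>\<open>y\<close> agrees with \<open>x\<close> on the whole window of this
      cylinder, so both images have the value of \<open>g z\<close> at 0.\<close>
    obtain z where z: "z \<in> F" "\<forall>i\<in>{- int (m z)..int (m z)}. x i = z i"
      using F(3) xy by blast
    have "\<forall>i\<in>{- int (m z)..int (m z)}. y i = z i"
    proof
      fix i assume i: "i \<in> {- int (m z)..int (m z)}"
      then show "y i = z i" using eq[of i] z r[OF z(1)] by auto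
    qed
    then show ?thesis using m[of z x] m[of z y] z F(2) xy by auto
  qed
  show ?thesis
  proof (rule that)
    fix x y :: "int \<Rightarrow> 'a" and j
    assume xy: "x \<in> X" "y \<in> X" and eq: "\<And>i. i \<in> {j - int r..j + int r} \<Longrightarrow> x i = y i"
    have "g (\<lambda>i. x (i + j)) 0 = g (\<lambda>i. y (i + j)) 0"
      using shift_commuting_translate[of X g, OF X comm] xy by (intro zero eq) auto
    then show "g x j = g y j"
      using shift_commuting_translate[of X g, OF X comm] xy by simp
  qed
qed

lemma cellular_automaton_funpow:
  assumes "subshift X" "cellular_automaton X f"
  shows "cellular_automaton X (f ^^ n)"
proof (induction n)
  case 0
  then show ?case by (simp add: cellular_automaton_def)
next
  case (Suc n)
  have top: "topspace (subtopology full_shift_topology X) = X"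
    using closedin_subset assms(1) unfolding subshift_def by fastforce
  have "continuous_map (subtopology full_shift_topology X) (subtopology full_shift_topology X)
      (f \<circ> (f ^^ n))"
    using Suc assms(2) unfolding cellular_automaton_def by (blast intro: continuous_map_compose)
  moreover have "f ((f ^^ n) (shift x)) = shift (f ((f ^^ n) x))" if "x \<in> X" for x
  proof -
    have "(f ^^ n) x \<in> X"
      using Suc that continuous_map_image_subset_topspace top unfolding cellular_automaton_def by blast
    then show ?thesis using Suc assms(2) that unfolding cellular_automaton_def by simp
  qed
  ultimately show ?case unfolding cellular_automaton_def by simp
qed

section \<open>Hamming distance on windows, the Besicovitch pseudometric, and the size of Hamming
  balls\<close>

definition hamming_dist :: "'i set \<Rightarrow> ('i \<Rightarrow> 'a) \<Rightarrow> ('i \<Rightarrow> 'a) \<Rightarrow> nat" where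
  "hamming_dist S x y = card {i \<in> S. x i \<noteq> y i}"

lemma hamming_dist_triangle:
  assumes "finite S"
  shows "hamming_dist S x z \<le> hamming_dist S x y + hamming_dist S y z"
proof -
  have "hamming_dist S x z \<le> card ({i \<in> S. x i \<noteq> y i} \<union> {i \<in> S. y i \<noteq> z i})"
    unfolding hamming_dist_def using assms by (intro card_mono) auto
  also have "\<dots> \<le> hamming_dist S x y + hamming_dist S y z"
    unfolding hamming_dist_def by (rule card_Un_le)
  finally show ?thesis .
qed

lemma hamming_dist_commute: "hamming_dist S x y = hamming_dist S y x"
  unfolding hamming_dist_def by (intro arg_cong[of _ _ card]) auto

lemma hamming_dist_cong:
  "(\<And>i. i \<in> S \<Longrightarrow> x i = x' i) \<Longrightarrow> (\<And>i. i \<in> S \<Longrightarrow> y i = y' i) \<Longrightarrow>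
    hamming_dist S x y = hamming_dist S x' y'"
  unfolding hamming_dist_def by (intro arg_cong[of _ _ card]) auto

text \<open>Trades the extended-real limsup for an eventual bound on window counts. The strictly
  smaller slope \<open>d\<close> is the room needed for open balls.\<close>

lemma besicovitch_dist_less_iff:
  "besicovitch_dist x y < e \<longleftrightarrow>
    (\<exists>d<e. \<forall>\<^sub>F n in sequentially. real (hamming_dist {- int n..int n} x y) \<le> d * (2 * real n + 1))"
proof -
  define q where "q n = real (hamming_dist {- int n..int n} x y) / (2 * real n + 1)" for n
  define l where "l = limsup (\<lambda>n. ereal (q n))"
  have dist: "besicovitch_dist x y = real_of_ereal l"
    unfolding besicovitch_dist_def l_def q_def hamming_dist_def ..
  have q: "0 \<le> q n" "q n \<le> 1" for n
  proof -
    have "hamming_dist {- int n..int n} x y \<le> card {- int n..int n}"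
      unfolding hamming_dist_def by (intro card_mono) auto
    then show "q n \<le> 1" unfolding q_def by (simp add: divide_le_eq)
  qed (simp add: q_def)
  have "l \<le> 1" unfolding l_def by (intro Limsup_bounded always_eventually) (simp add: q one_ereal_def)
  moreover have "0 \<le> l" unfolding l_def by (intro le_Limsup always_eventually) (auto simp: q)
  ultimately obtain r where r: "l = ereal r"
    by (cases l) auto
  have le: "real (hamming_dist {- int n..int n} x y) \<le> d * (2 * real n + 1) \<longleftrightarrow> q n \<le> d" for n d
    unfolding q_def by (simp add: pos_divide_le_eq)
  show ?thesis unfolding le dist r real_of_ereal.simps
  proof safe
    assume "r < e"
    \<comment> \<open>The midpoint lies strictly above the limsup, hence is an eventual bound, and
      still below \<open>e\<close>.\<close>
    then have "l < ereal ((r + e) / 2)" unfolding r by simp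
    then have "\<forall>\<^sub>F n in sequentially. ereal (q n) < ereal ((r + e) / 2)"
      unfolding l_def by (rule Limsup_lessD)
    then have "\<forall>\<^sub>F n in sequentially. q n \<le> (r + e) / 2"
      by (rule eventually_mono) simp
    then show "\<exists>d<e. \<forall>\<^sub>F n in sequentially. q n \<le> d"
      using \<open>r < e\<close> by (intro exI[of _ "(r + e) / 2"]) simp
  next
    fix d assume "d < e" "\<forall>\<^sub>F n in sequentially. q n \<le> d"
    then have "l \<le> ereal d" unfolding l_def by (intro Limsup_bounded) simp
    then show "r < e" using \<open>d < e\<close> r by simp
  qed
qed

text \<open>The slopes add under the Hamming triangle inequality, so the slack \<open>e - d\<close>
  is a radius that works around \<open>y\<close>.\<close>

lemma besicovitch_ball_open: "openin (besicovitch_topology X) {y \<in> X. besicovitch_dist x y < e}"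
  unfolding openin_besicovitch_topology
proof safe
  fix y assume "y \<in> X" "besicovitch_dist x y < e"
  then obtain d where d: "d < e"
    "\<forall>\<^sub>F n in sequentially. real (hamming_dist {- int n..int n} x y) \<le> d * (2 * real n + 1)"
    unfolding besicovitch_dist_less_iff by blast
  have "besicovitch_dist x z < e" if yz: "besicovitch_dist y z < e - d" for z
  proof -
    obtain d' where d': "d' < e - d"
      "\<forall>\<^sub>F n in sequentially. real (hamming_dist {- int n..int n} y z) \<le> d' * (2 * real n + 1)"
      using yz unfolding besicovitch_dist_less_iff by blast
    have "\<forall>\<^sub>F n in sequentially. real (hamming_dist {- int n..int n} x z) \<le> (d + d') * (2 * real n + 1)"
      using d(2) d'(2)
    proof eventually_elim
      case (elim n)
      have "hamming_dist {- int n..int n} x z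
          \<le> hamming_dist {- int n..int n} x y + hamming_dist {- int n..int n} y z"
        by (intro hamming_dist_triangle) simp
      with elim show ?case by (simp add: algebra_simps)
    qed
    then show ?thesis using d'(1) unfolding besicovitch_dist_less_iff
      by (intro exI[of _ "d + d'"]) simp
  qed
  then show "\<exists>\<epsilon>>0. \<forall>z\<in>X. besicovitch_dist y z < \<epsilon> \<longrightarrow> z \<in> {y \<in> X. besicovitch_dist x y < e}"
    using d(1) by (intro exI[of _ "e - d"]) auto
qed

lemma besicovitch_dist_refl: "besicovitch_dist x x = 0"
proof -
  have "(\<lambda>n::nat. ereal (real (card {i \<in> {- int n..int n}. x i \<noteq> x i}) / (2 * real n + 1))) = (\<lambda>n. 0)"
    by (simp add: zero_ereal_def)
  then show ?thesis unfolding besicovitch_dist_def by (simp add: Limsup_const)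
qed

text \<open>Weighting each configuration by \<open>t ^ (distance to p)\<close> turns the count into a product over \<open>S\<close>.\<close>

lemma card_hamming_ball_le:
  fixes p :: "'i \<Rightarrow> 'a::finite"
  assumes S: "finite S" and t: "0 < t" "t \<le> 1"
  shows "real (card {g \<in> S \<rightarrow>\<^sub>E UNIV. real (hamming_dist S p g) \<le> k}) * t powr k
    \<le> (1 + real CARD('a) * t) ^ card S"
proof -
  let ?B = "{g \<in> S \<rightarrow>\<^sub>E UNIV. real (hamming_dist S p g) \<le> k}"
  have fin: "finite (S \<rightarrow>\<^sub>E (UNIV :: 'a set))" using S by (intro finite_PiE) auto
  have "real (card ?B) * t powr k = (\<Sum>g\<in>?B. t powr k)" by simp
  also have "\<dots> \<le> (\<Sum>g\<in>?B. t ^ hamming_dist S p g)"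
  proof (intro sum_mono)
    fix g assume "g \<in> ?B"
    \<comment> \<open>As \<open>t\<close> is at most 1, every point of the ball has weight at least
      \<open>t powr k\<close>.\<close>
    then have "t powr k \<le> t powr (real (hamming_dist S p g))"
      using t by (intro powr_mono') auto
    then show "t powr k \<le> t ^ hamming_dist S p g" using t by (simp add: powr_realpow)
  qed
  also have "\<dots> \<le> (\<Sum>g\<in>S \<rightarrow>\<^sub>E UNIV. t ^ hamming_dist S p g)"
    using t fin by (intro sum_mono2) auto
  also have "\<dots> = (\<Sum>g\<in>S \<rightarrow>\<^sub>E UNIV. \<Prod>i\<in>S. if p i \<noteq> g i then t else 1)"
    unfolding hamming_dist_def using S
    by (intro sum.cong refl) (simp add: prod.If_cases Int_def)
  also have "\<dots> = (\<Prod>i\<in>S. \<Sum>a\<in>UNIV. if p i \<noteq> a then t else 1)"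
    by (rule prod_sum_PiE[symmetric]) (use S in auto)
  also have "\<dots> \<le> (\<Prod>i\<in>S. 1 + real CARD('a) * t)"
  proof (intro prod_mono conjI sum_nonneg)
    fix i
    \<comment> \<open>Letting the letter \<open>p i\<close> contribute \<open>t\<close> as well
      replaces \<open>CARD('a) - 1\<close> by \<open>CARD('a)\<close>.\<close>
    have "(\<Sum>a\<in>UNIV. if p i \<noteq> a then t else 1) \<le> (\<Sum>a\<in>UNIV. t + (if a = p i then 1 else 0))"
      using t by (intro sum_mono) auto
    then show "(\<Sum>a\<in>UNIV. if p i \<noteq> a then t else 1) \<le> 1 + real CARD('a) * t"
      by (simp add: sum.distrib)
  qed (use t in auto)
  finally show ?thesis by simp
qed

text \<open>The exponent \<open>c\<close> is split in halves: \<open>t\<close> is so small that the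
  product is at most \<open>exp (c / 2 * card S)\<close>, and \<open>e\<close> is then chosen so
  that dividing by the weight costs the same factor again.\<close>

lemma card_hamming_ball_le_exp:
  assumes "c > 0"
  obtains e where "e > 0" "\<And>S (p :: 'i \<Rightarrow> 'a::finite). finite S \<Longrightarrow>
    real (card {g \<in> S \<rightarrow>\<^sub>E UNIV. real (hamming_dist S p g) \<le> e * real (card S)}) \<le> exp (c * real (card S))"
proof -
  define A where "A = real CARD('a)"
  have A: "A > 0" unfolding A_def by simp
  define t where "t = min (1/2) (c / (2 * A))"
  have t: "0 < t" "t \<le> 1/2" "A * t \<le> c / 2"
    using A assms unfolding t_def by (auto simp: min_def field_simps)
  define e where "e = c / (2 * - ln t)"
  have lnt: "ln t < 0" using t by simp
  then have "e > 0" using assms unfolding e_def by (auto intro!: divide_pos_neg divide_neg_neg)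
  moreover have "real (card {g \<in> S \<rightarrow>\<^sub>E UNIV. real (hamming_dist S p g) \<le> e * real (card S)})
      \<le> exp (c * real (card S))" (is "real ?N \<le> _") if S: "finite S" for S and p :: "'i \<Rightarrow> 'a"
  proof -
    let ?m = "real (card S)"
    have "real ?N * t powr (e * ?m) \<le> (1 + A * t) ^ card S"
      unfolding A_def using card_hamming_ball_le[OF S, of t p "e * ?m"] t by simp
    also have "\<dots> \<le> exp (c / 2) ^ card S"
      using exp_ge_add_one_self[of "A * t"] t A by (intro power_mono order.trans[OF exp_ge_add_one_self]) auto
    also have "\<dots> = exp (c / 2 * ?m)" by (simp add: exp_of_nat_mult[symmetric] mult.commute)
    finally have *: "real ?N * t powr (e * ?m) \<le> exp (c / 2 * ?m)" .
    have "t powr (e * ?m) = exp (- (c / 2 * ?m))"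
      using t lnt unfolding powr_def e_def by simp
    with * have "real ?N * exp (- (c / 2 * ?m)) \<le> exp (c / 2 * ?m)" by simp
    then have "real ?N \<le> exp (c / 2 * ?m) * exp (c / 2 * ?m)"
      by (simp add: exp_minus divide_inverse[symmetric] pos_divide_le_eq)
    also have "\<dots> = exp (c * ?m)"
      by (simp add: exp_add[symmetric] field_simps)
    finally show ?thesis .
  qed
  ultimately show ?thesis using that by blast
qed

section \<open>A diagonal construction\<close>

text \<open>A Baire category argument by hand: for each \<open>n\<close> and \<open>m\<close> the
  sequences with \<open>P n K\<close> for some \<open>K\<close> at least \<open>m\<close> form an
  open dense set, and a point in all of them is built by successive extension.\<close>

lemma generic_sequence:
  fixes P :: "nat \<Rightarrow> nat \<Rightarrow> (int \<Rightarrow> 'b) \<Rightarrow> bool"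
  assumes local: "\<And>n K s s'. P n K s \<Longrightarrow> (\<And>i. \<bar>i\<bar> \<le> int K \<Longrightarrow> s i = s' i) \<Longrightarrow> P n K s'"
    and dense: "\<And>n K s. \<exists>K'>K. \<exists>s'. (\<forall>i. \<bar>i\<bar> \<le> int K \<longrightarrow> s' i = s i) \<and> P n K' s'"
  shows "\<exists>s. \<forall>n m. \<exists>K\<ge>m. P n K s"
proof -
  \<comment> \<open>A state is a window radius with a sequence that is settled on that window. Stage
    \<open>k\<close> handles the first component of the pair coded by \<open>k\<close>, so every
    \<open>n\<close> recurs.\<close>
  define step where "step k x y \<longleftrightarrow> fst y > fst x \<and>
      (\<forall>i. \<bar>i\<bar> \<le> int (fst x) \<longrightarrow> snd y i = snd x i) \<and> P (fst (prod_decode k)) (fst y) (snd y)"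
    for k and x y :: "nat \<times> (int \<Rightarrow> 'b)"
  have "\<exists>y. True \<and> step k x y" for k and x :: "nat \<times> (int \<Rightarrow> 'b)"
    using dense[of "fst x" "snd x" "fst (prod_decode k)"] unfolding step_def by auto
  then obtain h where h: "\<And>k. step k (h k) (h (Suc k))"
    using dependent_nat_choice[of "\<lambda>_ _. True" step] by auto
  have mono: "fst (h k) < fst (h (Suc k))" for k using h[of k] by (simp add: step_def)
  have ge: "k \<le> fst (h k)" for k
    by (rule seq_suble) (use mono in \<open>simp add: strict_mono_Suc_iff\<close>)
  have agree: "snd (h l) i = snd (h k) i" if "k \<le> l" "\<bar>i\<bar> \<le> int (fst (h k))" for k l i
    using that(1)
  proof (induction l rule: dec_induct)
    case (step l)
    have "fst (h k) \<le> fst (h l)"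
      using lift_Suc_mono_le[of "\<lambda>k. fst (h k)" k l] mono step.hyps(1) by (simp add: less_imp_le)
    then have "snd (h (Suc l)) i = snd (h l) i" using h[of l] that(2) by (auto simp: step_def)
    then show ?case using step.IH by simp
  qed simp
  \<comment> \<open>Radii grow by at least 1 per stage, so coordinate \<open>i\<close> is settled by
    stage \<open>nat \<bar>i\<bar>\<close>.\<close>
  define s where "s i = snd (h (nat \<bar>i\<bar>)) i" for i
  have s: "s i = snd (h k) i" if "\<bar>i\<bar> \<le> int (fst (h k))" for i k
  proof -
    have "\<bar>i\<bar> \<le> int (fst (h (nat \<bar>i\<bar>)))" using ge[of "nat \<bar>i\<bar>"] by linarith
    then show ?thesis unfolding s_def
      using agree[of "nat \<bar>i\<bar>" k i] agree[of k "nat \<bar>i\<bar>" i] that by (cases "nat \<bar>i\<bar> \<le> k") auto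
  qed
  have "\<exists>K\<ge>m. P n K s" for n m
  proof (intro exI conjI)
    \<comment> \<open>This stage handles \<open>n\<close>, and its code is at least
      \<open>m\<close>, which makes the radius reach \<open>m\<close>.\<close>
    let ?k = "prod_encode (n, m)"
    show "fst (h (Suc ?k)) \<ge> m"
      using ge[of "Suc ?k"] le_prod_encode_2[of m n] by linarith
    have "P n (fst (h (Suc ?k))) (snd (h (Suc ?k)))" using h[of ?k] by (simp add: step_def)
    then show "P n (fst (h (Suc ?k))) s" by (rule local) (simp add: s)
  qed
  then show ?thesis by blast
qed

section \<open>Counting shadowed words against block concatenations\<close>

text \<open>Finite-window form of the statement that \<open>g\<close> maps a point near
  \<open>p\<close> to a point near \<open>z\<close>. There are two radii because the image on radius
  \<open>N\<close> is determined only by a larger window, of radius \<open>M = N + r\<close> in the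
  uses below.\<close>

definition shadowed ::
  "(int \<Rightarrow> 'a) set \<Rightarrow> ((int \<Rightarrow> 'a) \<Rightarrow> (int \<Rightarrow> 'a)) \<Rightarrow> (int \<Rightarrow> 'a) \<Rightarrow> real \<Rightarrow> nat \<Rightarrow> nat \<Rightarrow> (int \<Rightarrow> 'a) \<Rightarrow> bool"
where
  "shadowed X g p e M N z \<longleftrightarrow> (\<exists>y\<in>X.
     real (hamming_dist {- int M..int M} p y) \<le> e * real (card {- int M..int M}) \<and>
     real (hamming_dist {- int N..int N} (g y) z) \<le> e * real (card {- int N..int N}))"

text \<open>Positions up to \<open>L * K\<close> in absolute value lie in blocks \<open>-K\<close>
  to \<open>K\<close>; block \<open>K\<close> is included because it starts at the right
  endpoint.\<close>

lemma block_config_cong: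
  assumes "L > 0" "\<bar>j\<bar> \<le> int (L * K)" "\<And>i. \<bar>i\<bar> \<le> int K \<Longrightarrow> s i = s' i"
  shows "block_config L a b s j = block_config L a b s' j"
proof -
  have j: "j \<le> int K * int L" "- int K * int L \<le> j"
    using assms(2) by (simp_all add: abs_le_iff mult.commute)
  have "j div int L \<le> (int K * int L) div int L" "(- int K * int L) div int L \<le> j div int L"
    by (intro zdiv_mono1 j; use assms(1) in simp)+
  moreover have "(int K * int L) div int L = int K" "(- int K * int L) div int L = - int K"
    by (rule nonzero_mult_div_cancel_right; use assms(1) in simp)+
  ultimately have "\<bar>j div int L\<bar> \<le> int K" by simp
  then show ?thesis unfolding block_config_def by (simp add: assms(3))
qed

text \<open>With \<open>N = L K'\<close>, the extensions of \<open>s\<close> give \<open>2 ^ (K' - K - 1)\<close> words on \<open>{-N..N}\<close>, whereas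
  the shadowed words number at most \<open>exp (c (4 N + 2 r + 2))\<close> with \<open>c = ln 2 / (8 L)\<close>, which is
  about \<open>2 ^ (K' / 2)\<close>.\<close>

lemma exists_unshadowed_extension:
  fixes X :: "(int \<Rightarrow> 'a::finite) set"
  assumes radius: "\<And>x y j. x \<in> X \<Longrightarrow> y \<in> X \<Longrightarrow>
      (\<And>i. i \<in> {j - int r..j + int r} \<Longrightarrow> x i = y i) \<Longrightarrow> g x j = g y j"
    and ab: "L > 0" "length a = L" "length b = L" "a \<noteq> b"
    and ball: "\<And>S (q :: int \<Rightarrow> 'a). finite S \<Longrightarrow>
      real (card {h \<in> S \<rightarrow>\<^sub>E UNIV. real (hamming_dist S q h) \<le> e * real (card S)})
        \<le> exp (ln 2 / (8 * real L) * real (card S))"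
  shows "\<exists>K'>K. \<exists>s'. (\<forall>i. \<bar>i\<bar> \<le> int K \<longrightarrow> s' i = s i) \<and>
    \<not> shadowed X g p e (L * K' + r) (L * K') (block_config L a b s')"
proof (rule ccontr)
  \<comment> \<open>With this value \<open>F\<close> has \<open>K + 2 * r + 5\<close> elements, one
    more than the bound \<open>K' / 2 + r + 1\<close> obtained below for the exponent of 2.\<close>
  define K' where "K' = 2 * K + 2 * r + 6"
  \<comment> \<open>Only blocks to the right of \<open>K\<close> are varied; as their indices stay
    below \<open>K'\<close>, they lie entirely in \<open>V\<close>.\<close>
  define F where "F = {int K<..<int K'}"
  define W where "W = {- int (L * K' + r)..int (L * K' + r)}"
  define V where "V = {- int (L * K')..int (L * K')}"
  define c where "c = ln 2 / (8 * real L)"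
  define ext where "ext h i = (if i \<in> F then h i else s i)" for h i
  let ?v = "\<lambda>h. block_config L a b (ext h)"
  assume "\<not> ?thesis"
  moreover have "K' > K" by (simp add: K'_def)
  moreover have "ext h i = s i" if "\<bar>i\<bar> \<le> int K" for h i
    using that by (auto simp: ext_def F_def)
  ultimately have "shadowed X g p e (L * K' + r) (L * K') (?v h)" for h
    by blast
  then have "\<exists>y\<in>X. real (hamming_dist W p y) \<le> e * real (card W) \<and>
      real (hamming_dist V (g y) (?v h)) \<le> e * real (card V)" for h
    unfolding shadowed_def V_def W_def .
  then obtain Y where Y: "\<And>h. Y h \<in> X"
    "\<And>h. real (hamming_dist W p (Y h)) \<le> e * real (card W)"
    "\<And>h. real (hamming_dist V (g (Y h)) (?v h)) \<le> e * real (card V)"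
    by metis
  \<comment> \<open>One representative in \<open>X\<close> for each pattern on \<open>W\<close>. By
    the radius, its image agrees on \<open>V\<close> with that of every point of \<open>X\<close>
    with the same pattern.\<close>
  define sel where "sel u = (SOME y. y \<in> X \<and> restrict y W = u)" for u
  have sel: "sel (restrict y W) \<in> X \<and> restrict (sel (restrict y W)) W = restrict y W" if "y \<in> X" for y
    unfolding sel_def by (rule someI[of _ y]) (use that in simp)
  let ?BW = "{u \<in> W \<rightarrow>\<^sub>E UNIV. real (hamming_dist W p u) \<le> e * real (card W)}"
  let ?BV = "\<lambda>u. {w \<in> V \<rightarrow>\<^sub>E UNIV. real (hamming_dist V (g (sel u)) w) \<le> e * real (card V)}"
  have fin: "finite W" "finite V" by (simp_all add: W_def V_def)
  have finB: "finite ?BW" "finite (?BV u)" for u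
    using fin by (simp_all add: finite_PiE)
  \<comment> \<open>The word on \<open>V\<close> alone determines \<open>h\<close>. The pattern on
    \<open>W\<close> is recorded to fix the centre of the Hamming ball containing that word, which
    allows counting pairs fibre by fibre.\<close>
  define \<Phi> where "\<Phi> h = (restrict (Y h) W, restrict (?v h) V)" for h
  have mem: "\<Phi> h \<in> Sigma ?BW ?BV" for h
  proof -
    let ?u = "restrict (Y h) W"
    have "hamming_dist W p ?u = hamming_dist W p (Y h)"
      by (rule hamming_dist_cong) auto
    moreover have "hamming_dist V (g (sel ?u)) (restrict (?v h) V) = hamming_dist V (g (Y h)) (?v h)"
    proof (rule hamming_dist_cong)
      fix j assume "j \<in> V"
      then have "i \<in> W" if "i \<in> {j - int r..j + int r}" for i
        using that by (auto simp: V_def W_def)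
      then show "g (sel ?u) j = g (Y h) j"
        using sel[OF Y(1)[of h]] Y(1)[of h] by (intro radius) (auto dest: fun_cong simp: restrict_def, metis)
    qed auto
    ultimately show ?thesis
      using Y(2,3)[of h] by (simp add: \<Phi>_def)
  qed
  have "inj_on \<Phi> (F \<rightarrow>\<^sub>E UNIV)"
  proof (rule inj_onI)
    fix h h' assume h: "h \<in> F \<rightarrow>\<^sub>E UNIV" "h' \<in> F \<rightarrow>\<^sub>E UNIV" and eq: "\<Phi> h = \<Phi> h'"
    \<comment> \<open>Reading position \<open>k\<close> of block \<open>i\<close> tells
      \<open>a\<close> from \<open>b\<close> and so recovers \<open>h i\<close>.\<close>
    obtain k where k: "k < L" "a ! k \<noteq> b ! k"
      using ab nth_equalityI[of a b] by auto
    have "h i = h' i" if i: "i \<in> F" for i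
    proof -
      let ?j = "int k + i * int L"
      have "0 \<le> i * int L" using i by (simp add: F_def)
      moreover have "(i + 1) * int L \<le> int K' * int L"
        using i by (intro mult_right_mono) (auto simp: F_def)
      ultimately have "?j \<in> V" using k(1) by (auto simp: V_def algebra_simps)
      then have "?v h ?j = ?v h' ?j"
        using eq unfolding \<Phi>_def by (metis prod.inject restrict_apply')
      moreover have "?j div int L = i" "?j mod int L = int k"
        using k(1) ab(1) by simp_all
      ultimately show ?thesis
        using i k(2) unfolding block_config_def ext_def by (auto split: if_splits)
    qed
    then show "h = h'" using h by (intro PiE_ext) auto
  qed
  then have "card (F \<rightarrow>\<^sub>E (UNIV :: bool set)) \<le> card (Sigma ?BW ?BV)"
    by (rule card_inj_on_le) (use mem in blast, intro finite_SigmaI finB)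
  moreover have "card (F \<rightarrow>\<^sub>E (UNIV :: bool set)) = 2 ^ (K + 2 * r + 5)"
    by (simp add: card_PiE F_def K'_def)
  ultimately have "2 ^ (K + 2 * r + 5) \<le> card (Sigma ?BW ?BV)" by simp
  then have "real (2 ^ (K + 2 * r + 5)) \<le> real (card (Sigma ?BW ?BV))"
    by (rule of_nat_mono)
  also have "\<dots> = (\<Sum>u\<in>?BW. real (card (?BV u)))"
    using finB by (subst card_SigmaI) auto
  also have "\<dots> \<le> (\<Sum>u\<in>?BW. exp (c * real (card V)))"
    unfolding c_def by (intro sum_mono ball fin)
  also have "\<dots> \<le> exp (c * real (card W)) * exp (c * real (card V))"
    using ball[OF fin(1), of p] unfolding c_def by simp
  also have "\<dots> = exp (c * (4 * real L * real K' + 2 * real r + 2))"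
  proof -
    have "real (card W) = 2 * real L * real K' + 2 * real r + 1" "real (card V) = 2 * real L * real K' + 1"
      by (simp_all add: W_def V_def)
    then show ?thesis by (simp add: exp_add[symmetric] algebra_simps)
  qed
  also have "\<dots> < exp (ln 2 * real (K + 2 * r + 5))"
  proof -
    have "c * (4 * real L * real K' + 2 * real r + 2) = ln 2 * (real K' / 2 + (real r + 1) / (4 * real L))"
      using ab(1) unfolding c_def by (simp add: field_simps)
    also have "(real r + 1) / (4 * real L) \<le> real r + 1"
    proof -
      have "(real r + 1) * 1 \<le> (real r + 1) * (4 * real L)"
        using ab(1) by (intro mult_left_mono) auto
      then show ?thesis using ab(1) by (simp add: pos_divide_le_eq)
    qed
    finally have "c * (4 * real L * real K' + 2 * real r + 2) \<le> ln 2 * (real K' / 2 + (real r + 1))"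
      by simp
    also have "\<dots> < ln 2 * real (K + 2 * r + 5)"
      by (intro mult_strict_left_mono) (simp_all add: K'_def)
    finally show ?thesis by simp
  qed
  also have "\<dots> = real (2 ^ (K + 2 * r + 5))"
  proof -
    have "exp (ln 2 * real (K + 2 * r + 5)) = exp (ln (2::real)) ^ (K + 2 * r + 5)"
      unfolding exp_of_nat_mult[symmetric] by (simp only: mult.commute)
    then show ?thesis by simp
  qed
  finally show False by simp
qed

section \<open>Two Besicovitch balls that no iterate connects\<close>

theorem theorem9:
  fixes X :: "(int \<Rightarrow> 'a::finite) set"
  assumes "sofic_shift X" and "entropy X > 0"
  shows "\<not> (\<exists>f. cellular_automaton X f \<and>
    topologically_transitive (besicovitch_topology X) f)"
proof
  assume "\<exists>f. cellular_automaton X f \<and> topologically_transitive (besicovitch_topology X) f"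
  then obtain f where f: "cellular_automaton X f"
    and trans: "topologically_transitive (besicovitch_topology X) f"
    by blast
  have X: "subshift X" using assms(1) by (simp add: sofic_shift_def)
  obtain L a b where ab: "L > 0" "length a = L" "length b = L" "a \<noteq> b"
    and blocks: "\<And>s. block_config L a b s \<in> X"
    using sofic_positive_entropy_blocks[OF assms] by blast
  let ?v = "block_config L a b"
  define p where "p = ?v (\<lambda>_. True)"
  have "ln 2 / (8 * real L) > 0" using ab(1) by simp
  then obtain e where "e > 0" and ball: "\<And>S (q :: int \<Rightarrow> 'a). finite S \<Longrightarrow>
      real (card {h \<in> S \<rightarrow>\<^sub>E UNIV. real (hamming_dist S q h) \<le> e * real (card S)})
        \<le> exp (ln 2 / (8 * real L) * real (card S))"
    using card_hamming_ball_le_exp by blast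
  have "\<exists>r. \<forall>x\<in>X. \<forall>y\<in>X. \<forall>j. (\<forall>i\<in>{j - int r..j + int r}. x i = y i) \<longrightarrow>
      (f ^^ n) x j = (f ^^ n) y j" for n
    using curtis_hedlund_lyndon[OF X cellular_automaton_funpow[OF X f, of n]] by metis
  then obtain r where r: "\<And>n x y j. x \<in> X \<Longrightarrow> y \<in> X \<Longrightarrow>
      (\<And>i. i \<in> {j - int (r n)..j + int (r n)} \<Longrightarrow> x i = y i) \<Longrightarrow> (f ^^ n) x j = (f ^^ n) y j"
    by metis
  \<comment> \<open>A single \<open>s\<close> must defeat all iterates, whose radii
    \<open>r n\<close> may grow without control; each \<open>n\<close> therefore gets its own
    arbitrarily large scales.\<close>
  have "\<exists>s. \<forall>n m. \<exists>K\<ge>m. \<not> shadowed X (f ^^ n) p e (L * K + r n) (L * K) (?v s)"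
  proof (rule generic_sequence[of "\<lambda>n K s. \<not> shadowed X (f ^^ n) p e (L * K + r n) (L * K) (?v s)"])
    fix n K and s s' :: "int \<Rightarrow> bool"
    assume "\<And>i. \<bar>i\<bar> \<le> int K \<Longrightarrow> s i = s' i"
    then have "?v s j = ?v s' j" if "j \<in> {- int (L * K)..int (L * K)}" for j
      using block_config_cong[OF ab(1), of j K s s'] that by (auto simp: abs_le_iff)
    then have "hamming_dist {- int (L * K)..int (L * K)} x (?v s)
        = hamming_dist {- int (L * K)..int (L * K)} x (?v s')" for x
      by (intro hamming_dist_cong) auto
    then show "\<not> shadowed X (f ^^ n) p e (L * K + r n) (L * K) (?v s')"
      if "\<not> shadowed X (f ^^ n) p e (L * K + r n) (L * K) (?v s)"
      using that unfolding shadowed_def by simp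
  next
    show "\<exists>K'>K. \<exists>s'. (\<forall>i. \<bar>i\<bar> \<le> int K \<longrightarrow> s' i = s i) \<and>
      \<not> shadowed X (f ^^ n) p e (L * K' + r n) (L * K') (?v s')" for n K s
      by (rule exists_unshadowed_extension[OF r ab ball])
  qed
  then obtain s where s: "\<And>n m. \<exists>K\<ge>m. \<not> shadowed X (f ^^ n) p e (L * K + r n) (L * K) (?v s)"
    by blast
  let ?U = "\<lambda>x. {y \<in> X. besicovitch_dist x y < e}"
  have "p \<in> ?U p" "?v s \<in> ?U (?v s)"
    using blocks \<open>e > 0\<close> by (auto simp: p_def besicovitch_dist_refl)
  then have "?U p \<noteq> {}" "?U (?v s) \<noteq> {}" by blast+
  then obtain n where "(f ^^ n) ` ?U p \<inter> ?U (?v s) \<noteq> {}"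
    using trans[unfolded topologically_transitive_def, rule_format, of "?U p" "?U (?v s)"]
      besicovitch_ball_open[of X p e] besicovitch_ball_open[of X "?v s" e] by blast
  then obtain y where y: "y \<in> X" "besicovitch_dist p y < e" "besicovitch_dist (?v s) ((f ^^ n) y) < e"
    by blast
  \<comment> \<open>The slope \<open>d\<close> below \<open>e\<close> and the window size
    \<open>2 * N + 1\<close> turn Besicovitch closeness into the bound in \<open>shadowed\<close>
    for all large windows.\<close>
  have close: "\<exists>N0. \<forall>N\<ge>N0. real (hamming_dist {- int N..int N} x z) \<le> e * real (card {- int N..int N})"
    if xz: "besicovitch_dist x z < e" for x z :: "int \<Rightarrow> 'a"
  proof -
    obtain d N0 where d: "d < e"
      "\<And>N. N \<ge> N0 \<Longrightarrow> real (hamming_dist {- int N..int N} x z) \<le> d * (2 * real N + 1)"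
      using xz unfolding besicovitch_dist_less_iff eventually_sequentially by blast
    have "d * (2 * real N + 1) \<le> e * real (card {- int N..int N})" for N
      using d(1) by (simp add: mult_right_mono)
    with d(2) show ?thesis by (meson order.trans)
  qed
  obtain N1 where N1: "\<And>N. N \<ge> N1 \<Longrightarrow>
      real (hamming_dist {- int N..int N} p y) \<le> e * real (card {- int N..int N})"
    using close[OF y(2)] by blast
  obtain N2 where N2: "\<And>N. N \<ge> N2 \<Longrightarrow>
      real (hamming_dist {- int N..int N} (?v s) ((f ^^ n) y)) \<le> e * real (card {- int N..int N})"
    using close[OF y(3)] by blast
  \<comment> \<open>The thresholds \<open>N1\<close> and \<open>N2\<close> depend on
    \<open>y\<close>, which was found after \<open>s\<close>; hence the need for infinitely many
    unshadowed scales for each \<open>n\<close>.\<close>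
  obtain K where K: "K \<ge> max N1 N2" "\<not> shadowed X (f ^^ n) p e (L * K + r n) (L * K) (?v s)"
    using s by blast
  have "K \<le> L * K" using ab(1) by simp
  then have "N1 \<le> L * K + r n" "N2 \<le> L * K" using K(1) by linarith+
  then have "shadowed X (f ^^ n) p e (L * K + r n) (L * K) (?v s)"
    unfolding shadowed_def hamming_dist_commute[of _ "(f ^^ n) _"] using y(1) N1 N2 by blast
  with K(2) show False ..
qed

end
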